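(* Let $\mathcal{A}$ be an arbitrary C*-algebra of compact operators, $E$ a Hilbert $\mathcal{A}$-module and $T\in\mathcal{L}(E)$. Then the following assertions are pairwise equivalent. (1) $T$ has a nontrivial invariant submodule. (2) There exists a nontrivial projection $P\in\mathcal{L}(E)$ such that $PTP=TP$. (3) The operator equation $STS=TS$ has a nontrivial solution (i.e., a solution $S\in\mathcal{L}(E)$ such that $0\neq S\neq I$).
   Context: A C*-algebra of compact operators is a C*-algebra that is a C*-subalgebra of $\mathcal{K}(H)$, the compact operators on some Hilbert space $H$. Hilbert $\mathcal{A}$-modules are right Hilbert C*-modules with $\mathcal{A}$-valued inner product, linear in the second variable. $\mathcal{L}(E)$ is the C*-algebra of all adjointable operators on $E$, $I$ the identity operator. A closed submodule $W$ of $E$ is an invariant submodule for $T$ if $T(W)\subseteq W$; it is nontrivial if $\{0\}\neq W\neq E$. A projection means an orthogonal projection $P=P^*=P^2$; it is nontrivial if $0\neq P\neq I$.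
   Formalization: The equivalence of (3) with (1) and (2) is stated except when T = 0 and E is nonzero with no nontrivial closed submodule; there it fails, since S = 2I solves STS = TS but (1) and (2) are false. (1)⇔(2) holds without exception. *)

theory Defs
  imports "HOL-Analysis.Analysis" "HOL-Library.Nonpos_Ints"
begin

section \<open>Complex normed spaces and Hilbert spaces\<close>

class scaleC =
  fixes scaleC :: "complex \<Rightarrow> 'a \<Rightarrow> 'a"  (infixr "*\<^sub>C" 75)

class complex_normed_vector = real_normed_vector + scaleC +
  assumes scaleC_add_right: "c *\<^sub>C (x + y) = c *\<^sub>C x + c *\<^sub>C y"
    and scaleC_add_left: "(c + d) *\<^sub>C x = c *\<^sub>C x + d *\<^sub>C x"
    and scaleC_scaleC: "c *\<^sub>C (d *\<^sub>C x) = (c * d) *\<^sub>C x"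
    and scaleC_of_real: "complex_of_real r *\<^sub>C x = r *\<^sub>R x"
    and norm_scaleC: "norm (c *\<^sub>C x) = cmod c * norm x"

text \<open>Inner products are linear in the second variable.\<close>

class complex_hilbert = complex_normed_vector + banach +
  fixes cinner :: "'a \<Rightarrow> 'a \<Rightarrow> complex"
  assumes cinner_add_right: "cinner x (y + z) = cinner x y + cinner x z"
    and cinner_scaleC_right: "cinner x (c *\<^sub>C y) = c * cinner x y"
    and cinner_commute: "cinner y x = cnj (cinner x y)"
    and cinner_nonneg: "cinner x x \<in> \<real>\<^sub>\<ge>\<^sub>0"
    and norm_eq_sqrt_cinner: "norm x = sqrt (cmod (cinner x x))"

instantiation blinfun :: (real_normed_vector, complex_normed_vector) complex_normed_vector
begin

lift_definition scaleC_blinfun :: "complex \<Rightarrow> 'a \<Rightarrow>\<^sub>L 'b \<Rightarrow> 'a \<Rightarrow>\<^sub>L 'b"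
  is "\<lambda>c f x. c *\<^sub>C f x"
proof -
  fix c :: complex and f :: "'a \<Rightarrow> 'b"
  assume f: "bounded_linear f"
  obtain K where K: "\<And>x. norm (f x) \<le> norm x * K"
    using bounded_linear.bounded[OF f] by blast
  have comm: "c *\<^sub>C (r *\<^sub>R y) = r *\<^sub>R (c *\<^sub>C y)" for r and y :: 'b
    by (metis scaleC_of_real scaleC_scaleC mult.commute)
  show "bounded_linear (\<lambda>x. c *\<^sub>C f x)"
  proof (rule bounded_linear_intro)
    show "norm (c *\<^sub>C f x) \<le> norm x * (cmod c * K)" for x
      using mult_left_mono[OF K[of x] norm_ge_zero[of c]]
      by (simp add: norm_scaleC mult.left_commute)
  qed (simp_all add: linear_simps[OF f] scaleC_add_right comm)
qed

instance
proof
  fix c d :: complex and r :: real and f g :: "'a \<Rightarrow>\<^sub>L 'b"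
  have le: "norm (c *\<^sub>C f) \<le> cmod c * norm f" for c and f :: "'a \<Rightarrow>\<^sub>L 'b"
  proof (rule norm_blinfun_bound)
    show "norm (blinfun_apply (c *\<^sub>C f) x) \<le> cmod c * norm f * norm x" for x
      using mult_left_mono[OF norm_blinfun[of f x] norm_ge_zero[of c]]
      by (simp add: scaleC_blinfun.rep_eq norm_scaleC mult.assoc)
  qed simp
  show "c *\<^sub>C (f + g) = c *\<^sub>C f + c *\<^sub>C g"
    by transfer (simp add: scaleC_add_right)
  show "(c + d) *\<^sub>C f = c *\<^sub>C f + d *\<^sub>C f"
    by transfer (simp add: scaleC_add_left)
  show ss: "c *\<^sub>C d *\<^sub>C f = (c * d) *\<^sub>C f" for c d and f :: "'a \<Rightarrow>\<^sub>L 'b"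
    by transfer (simp add: scaleC_scaleC)
  show sr: "complex_of_real r *\<^sub>C f = r *\<^sub>R f" for r and f :: "'a \<Rightarrow>\<^sub>L 'b"
    by transfer (simp add: scaleC_of_real)
  show "norm (c *\<^sub>C f) = cmod c * norm f"
  proof (cases "c = 0")
    case True
    then show ?thesis using sr[of 0 f] by simp
  next
    case False
    have "inverse c *\<^sub>C (c *\<^sub>C f) = f"
      using False sr[of 1 f] by (simp add: ss)
    then have "norm f \<le> inverse (cmod c) * norm (c *\<^sub>C f)"
      by (metis le norm_inverse)
    from mult_left_mono[OF this norm_ge_zero[of c]]
    have "cmod c * norm f \<le> norm (c *\<^sub>C f)"
      using False by (simp flip: mult.assoc)
    with le[of c f] show ?thesis by simp
  qed
qed

end

section \<open>C*-algebras of compact operators\<close>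

text \<open>The library type of bounded linear operators is real-linear, so complex linearity
  is imposed separately. The operator norm is the same for real- and complex-linear operators.\<close>

definition compact_operators :: "('h::complex_hilbert \<Rightarrow>\<^sub>L 'h) set" where
  "compact_operators =
     {a. (\<forall>c x. blinfun_apply a (c *\<^sub>C x) = c *\<^sub>C blinfun_apply a x) \<and>
         compact (closure (blinfun_apply a ` cball 0 1))}"

definition is_operator_adjoint :: "('h::complex_hilbert \<Rightarrow>\<^sub>L 'h) \<Rightarrow> ('h \<Rightarrow>\<^sub>L 'h) \<Rightarrow> bool" where
  "is_operator_adjoint b a \<longleftrightarrow>
     (\<forall>x y. cinner (blinfun_apply b x) y = cinner x (blinfun_apply a y))"

definition positive_operator :: "('h::complex_hilbert \<Rightarrow>\<^sub>L 'h) \<Rightarrow> bool" where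
  "positive_operator a \<longleftrightarrow> (\<forall>h. cinner h (blinfun_apply a h) \<in> \<real>\<^sub>\<ge>\<^sub>0)"

definition compact_operator_algebra :: "('h::complex_hilbert \<Rightarrow>\<^sub>L 'h) set \<Rightarrow> bool" where
  "compact_operator_algebra A \<longleftrightarrow>
     A \<subseteq> compact_operators \<and> closed A \<and> 0 \<in> A \<and>
     (\<forall>a\<in>A. \<forall>b\<in>A. a + b \<in> A \<and> a o\<^sub>L b \<in> A) \<and>
     (\<forall>c. \<forall>a\<in>A. c *\<^sub>C a \<in> A) \<and>
     (\<forall>a\<in>A. \<exists>b\<in>A. is_operator_adjoint b a)"

section \<open>Hilbert modules\<close>

text \<open>The type \<open>'e\<close> is the whole module \<open>E\<close>, with right action \<open>act\<close> and \<open>A\<close>-valued inner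
  product \<open>ip\<close>; \<open>act x a\<close> is meaningful for \<open>a \<in> A\<close> only. Completeness for the norm induced
  by \<open>ip\<close> is expressed by \<open>banach\<close> together with \<open>norm_eq\<close>, which also gives definiteness.\<close>

locale hilbert_module =
  fixes A :: "('h::complex_hilbert \<Rightarrow>\<^sub>L 'h) set"
    and act :: "'e::{complex_normed_vector, banach} \<Rightarrow> ('h \<Rightarrow>\<^sub>L 'h) \<Rightarrow> 'e"
    and ip :: "'e \<Rightarrow> 'e \<Rightarrow> ('h \<Rightarrow>\<^sub>L 'h)"
  assumes algebra: "compact_operator_algebra A"
    and act_add_left: "a \<in> A \<Longrightarrow> act (x + y) a = act x a + act y a"
    and act_add_right: "a \<in> A \<Longrightarrow> b \<in> A \<Longrightarrow> act x (a + b) = act x a + act x b"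
    and act_mult: "a \<in> A \<Longrightarrow> b \<in> A \<Longrightarrow> act x (a o\<^sub>L b) = act (act x a) b"
    and act_scaleC_left: "a \<in> A \<Longrightarrow> act (c *\<^sub>C x) a = c *\<^sub>C act x a"
    and act_scaleC_right: "a \<in> A \<Longrightarrow> act x (c *\<^sub>C a) = c *\<^sub>C act x a"
    and ip_in: "ip x y \<in> A"
    and ip_add_right: "ip x (y + z) = ip x y + ip x z"
    and ip_scaleC_right: "ip x (c *\<^sub>C y) = c *\<^sub>C ip x y"
    and ip_act_right: "a \<in> A \<Longrightarrow> ip x (act y a) = ip x y o\<^sub>L a"
    and ip_adjoint: "is_operator_adjoint (ip y x) (ip x y)"
    and ip_positive: "positive_operator (ip x x)"
    and norm_eq: "norm x = sqrt (norm (ip x x))"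

definition is_adjoint :: "('e \<Rightarrow> 'e \<Rightarrow> 'a) \<Rightarrow> ('e \<Rightarrow> 'e) \<Rightarrow> ('e \<Rightarrow> 'e) \<Rightarrow> bool" where
  "is_adjoint ip T' T \<longleftrightarrow> (\<forall>x y. ip (T x) y = ip x (T' y))"

text \<open>No linearity or boundedness is required: both are automatic for adjointable maps.\<close>

definition adjointable_operators :: "('e \<Rightarrow> 'e \<Rightarrow> 'a) \<Rightarrow> ('e \<Rightarrow> 'e) set" where
  "adjointable_operators ip = {T. \<exists>T'. is_adjoint ip T' T}"

definition is_projection :: "('e \<Rightarrow> 'e \<Rightarrow> 'a) \<Rightarrow> ('e \<Rightarrow> 'e) \<Rightarrow> bool" where
  "is_projection ip P \<longleftrightarrow> P \<in> adjointable_operators ip \<and> is_adjoint ip P P \<and> P \<circ> P = P"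

definition closed_submodule ::
    "('h::complex_hilbert \<Rightarrow>\<^sub>L 'h) set \<Rightarrow> ('e::complex_normed_vector \<Rightarrow> ('h \<Rightarrow>\<^sub>L 'h) \<Rightarrow> 'e)
      \<Rightarrow> 'e set \<Rightarrow> bool" where
  "closed_submodule A act W \<longleftrightarrow>
     closed W \<and> 0 \<in> W \<and> (\<forall>x\<in>W. \<forall>y\<in>W. x + y \<in> W) \<and>
     (\<forall>c. \<forall>x\<in>W. c *\<^sub>C x \<in> W) \<and> (\<forall>x\<in>W. \<forall>a\<in>A. act x a \<in> W)"

definition has_invariant_submodule ::
    "('h::complex_hilbert \<Rightarrow>\<^sub>L 'h) set \<Rightarrow> ('e::complex_normed_vector \<Rightarrow> ('h \<Rightarrow>\<^sub>L 'h) \<Rightarrow> 'e)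
      \<Rightarrow> ('e \<Rightarrow> 'e) \<Rightarrow> bool" where
  "has_invariant_submodule A act T \<longleftrightarrow>
     (\<exists>W. closed_submodule A act W \<and> W \<noteq> {0} \<and> W \<noteq> UNIV \<and> T ` W \<subseteq> W)"

definition has_invariant_projection ::
    "('e::zero \<Rightarrow> 'e \<Rightarrow> 'a) \<Rightarrow> ('e \<Rightarrow> 'e) \<Rightarrow> bool" where
  "has_invariant_projection ip T \<longleftrightarrow>
     (\<exists>P. is_projection ip P \<and> P \<noteq> (\<lambda>_. 0) \<and> P \<noteq> id \<and> P \<circ> T \<circ> P = T \<circ> P)"

definition has_nontrivial_solution ::
    "('e::zero \<Rightarrow> 'e \<Rightarrow> 'a) \<Rightarrow> ('e \<Rightarrow> 'e) \<Rightarrow> bool" where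
  "has_nontrivial_solution ip T \<longleftrightarrow>
     (\<exists>S\<in>adjointable_operators ip. S \<noteq> (\<lambda>_. 0) \<and> S \<noteq> id \<and> S \<circ> T \<circ> S = T \<circ> S)"

definition simple_module ::
    "('h::complex_hilbert \<Rightarrow>\<^sub>L 'h) set \<Rightarrow> ('e::complex_normed_vector \<Rightarrow> ('h \<Rightarrow>\<^sub>L 'h) \<Rightarrow> 'e)
      \<Rightarrow> bool" where
  "simple_module A act \<longleftrightarrow>
     (UNIV :: 'e set) \<noteq> {0} \<and> (\<forall>W. closed_submodule A act W \<longrightarrow> W = {0} \<or> W = UNIV)"

section \<open>Zero operators on simple modules\<close>

text \<open>For \<open>T = 0\<close> every operator \<open>S\<close> solves \<open>S T S = T S\<close>, for instance \<open>S = 2 I\<close>, whereas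
  a simple module has no nontrivial closed submodule. So a nontrivial solution of the equation
  does not give an invariant submodule when \<open>T = 0\<close> and the module is simple.\<close>

lemma zero_on_simple_module:
  fixes A :: "('h::complex_hilbert \<Rightarrow>\<^sub>L 'h) set"
    and act :: "'e::{complex_normed_vector, banach} \<Rightarrow> ('h \<Rightarrow>\<^sub>L 'h) \<Rightarrow> 'e"
    and T :: "'e \<Rightarrow> 'e"
  assumes mod: "hilbert_module A act ip" and simple: "simple_module A act"
    and T: "T = (\<lambda>_. 0)"
  shows "has_nontrivial_solution ip T" and "\<not> has_invariant_submodule A act T"
proof -
  interpret hilbert_module A act ip by fact
  obtain z :: 'e where z: "z \<noteq> 0"
    using simple unfolding simple_module_def by blast
  define S :: "'e \<Rightarrow> 'e" where "S = (\<lambda>x. x + x)"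
  have Sz: "S z \<noteq> 0" "S z \<noteq> z"
    using z scaleR_2[of z] by (auto simp: S_def)
  have left: "ip (x + x) y = ip x y + ip x y" for x y
  proof (rule blinfun_eqI)
    fix k
    let ?u = "blinfun_apply (ip (x + x) y) k - (blinfun_apply (ip x y) k + blinfun_apply (ip x y) k)"
    have *: "cinner h (blinfun_apply (ip u y) k) = cinner (blinfun_apply (ip y u) h) k" for h u
      using ip_adjoint[of y u] unfolding is_operator_adjoint_def by simp
    have addl: "cinner (a + b) c = cinner a c + cinner b c" for a b c :: 'h
      by (metis cinner_add_right cinner_commute complex_cnj_add)
    have "cinner h (blinfun_apply (ip (x + x) y) k)
        = cinner h (blinfun_apply (ip x y) k + blinfun_apply (ip x y) k)" for h
      by (simp add: * ip_add_right blinfun.add_left addl cinner_add_right)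
    then have "cinner ?u ?u = 0"
      by (metis (no_types) add_diff_cancel_left' cinner_add_right diff_add_cancel right_minus_eq
          cancel_comm_monoid_add_class.diff_cancel)
    then have "norm ?u = 0" by (simp add: norm_eq_sqrt_cinner)
    then show "blinfun_apply (ip (x + x) y) k = blinfun_apply (ip x y + ip x y) k"
      by (simp add: blinfun.add_left)
  qed
  have "is_adjoint ip S S"
    unfolding is_adjoint_def S_def by (simp add: left ip_add_right)
  moreover have "S \<circ> T \<circ> S = T \<circ> S" by (auto simp: T S_def)
  moreover have "S \<noteq> (\<lambda>_. 0)" "S \<noteq> id" using Sz by (metis, metis id_apply)
  ultimately show "has_nontrivial_solution ip T"
    unfolding has_nontrivial_solution_def adjointable_operators_def by blast
  show "\<not> has_invariant_submodule A act T"
    using simple unfolding simple_module_def has_invariant_submodule_def by blast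
qed

end

theory Submission
  imports Defs
begin

text \<open>Everything rests on one property of Hilbert modules over algebras of compact operators:
  each closed submodule W has an orthogonal complement (\<open>complemented_part_eq_UNIV\<close>).
  Given this, an invariant W yields the projection onto W (\<open>obtain_projection\<close>).
  Conversely, the fixed points of a projection P with PTP = TP form an invariant submodule, and such
  a P also solves STS = TS. For a solution S, the double complement of its range is invariant. If it
  is all of E, taking adjoints gives ST = T, so the fixed points of S are invariant and contain the
  range of T. That leaves T = 0, for which any nontrivial closed submodule will do; a simple module
  has none, although S = 2I is still a solution, whence the exception in the statement.

  Complements come from a minimisation (\<open>act_in_complemented_part\<close>). The norm of E need
  not satisfy the parallelogram law, so a scalar quadratic form, a weighted sum of values
  \<open>Q u h\<close>, is minimised over part of x + W. Convergence in this form is weaker than in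
  norm, but multiplying by a compact b \<in> A makes up for it. So each x b splits along W and its
  complement; the set of vectors that split is closed (\<open>closed_complemented_part\<close>), and
  a suitable multiple of any vector x is a limit of its own products with elements of A
  (\<open>in_closure_act_range\<close>).\<close>

section \<open>Inner products\<close>

lemma scaleC_minus1: "(-1) *\<^sub>C x = - (x::'a::complex_normed_vector)"
  using scaleC_of_real[of "-1" x] by simp

lemma cinner_add_left: "cinner (x + y) z = cinner x z + cinner y (z::'h::complex_hilbert)"
  by (metis cinner_add_right cinner_commute complex_cnj_add)

lemma cinner_scaleC_left: "cinner (c *\<^sub>C x) y = cnj c * cinner x (y::'h::complex_hilbert)"
  by (metis cinner_scaleC_right cinner_commute complex_cnj_mult)

lemma cinner_minus_right: "cinner x (- y) = - cinner x (y::'h::complex_hilbert)"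
  using cinner_scaleC_right[of x "-1" y] by (simp add: scaleC_minus1)

lemma cinner_minus_left: "cinner (- x) y = - cinner x (y::'h::complex_hilbert)"
  by (metis cinner_minus_right cinner_commute complex_cnj_minus)

lemma cinner_diff_right: "cinner x (y - z) = cinner x y - cinner x (z::'h::complex_hilbert)"
  using cinner_add_right[of x y "- z"] by (simp add: cinner_minus_right)

lemma cinner_diff_left: "cinner (x - y) z = cinner x z - cinner y (z::'h::complex_hilbert)"
  using cinner_add_left[of x "- y" z] by (simp add: cinner_minus_left)

lemma cinner_scaleR_right: "cinner x (r *\<^sub>R y) = r * cinner x (y::'h::complex_hilbert)"
  by (metis cinner_scaleC_right scaleC_of_real)

lemma cinner_scaleR_left: "cinner (r *\<^sub>R x) y = r * cinner x (y::'h::complex_hilbert)"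
  by (metis cinner_scaleC_left scaleC_of_real complex_cnj_complex_of_real)

lemma cinner_self: "cinner x x = (norm (x::'h::complex_hilbert))\<^sup>2"
proof -
  obtain r where "cinner x x = of_real r" "r \<ge> 0"
    using cinner_nonneg[of x] by (auto simp: nonneg_Reals_def)
  then show ?thesis
    using norm_eq_sqrt_cinner[of x] by simp
qed

lemma cinner_ext:
  assumes "\<And>h. cinner h x = cinner h (y::'h::complex_hilbert)"
  shows "x = y"
proof -
  have "cinner (x - y) (x - y) = 0"
    using assms by (simp add: cinner_diff_right)
  then show ?thesis by (simp add: cinner_self)
qed

lemma cinner_Cauchy_Schwarz: "cmod (cinner x y) \<le> norm x * norm (y::'h::complex_hilbert)"
proof (cases "y = 0")
  case True
  have "cinner x 0 = 0" using cinner_add_right[of x 0 0] by simp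
  with True show ?thesis by simp
next
  case False
  define c where "c = cinner y x / (norm y)\<^sup>2"
  have yx: "cinner y x * cinner x y = (cmod (cinner x y))\<^sup>2"
    by (metis cinner_commute complex_norm_square mult.commute)
  have c: "cnj c = cinner x y / (norm y)\<^sup>2"
    by (simp add: c_def cinner_commute[of y x])
  have "complex_of_real ((norm (x - c *\<^sub>C y))\<^sup>2)
      = (norm x)\<^sup>2 - c * cinner x y - cnj c * cinner y x + cnj c * c * (norm y)\<^sup>2"
    unfolding cinner_self[symmetric]
    by (simp add: cinner_diff_left cinner_diff_right cinner_scaleC_left cinner_scaleC_right
        algebra_simps)
  then have "complex_of_real ((norm (x - c *\<^sub>C y))\<^sup>2)
      = complex_of_real ((norm x)\<^sup>2 - (cmod (cinner x y))\<^sup>2 / (norm y)\<^sup>2)"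
    unfolding c using False yx by (simp add: c_def divide_simps power2_eq_square)
  then have "(norm (x - c *\<^sub>C y))\<^sup>2 = (norm x)\<^sup>2 - (cmod (cinner x y))\<^sup>2 / (norm y)\<^sup>2"
    by (simp only: of_real_eq_iff)
  then have "(cmod (cinner x y))\<^sup>2 / (norm y)\<^sup>2 \<le> (norm x)\<^sup>2"
    by (metis diff_ge_0_iff_ge zero_le_power2)
  then have "(cmod (cinner x y))\<^sup>2 \<le> (norm x * norm y)\<^sup>2"
    using False by (simp add: divide_simps power_mult_distrib)
  then show ?thesis
    by (rule power2_le_imp_le) simp
qed

section \<open>Finite nets, rescaling and closed submodules\<close>

lemma compact_dense_sequence:
  fixes K :: "'a::metric_space set"
  assumes "compact K" "K \<noteq> {}"
  obtains h :: "nat \<Rightarrow> 'a" where "range h \<subseteq> K"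
    "\<And>e. e > 0 \<Longrightarrow> \<exists>I. finite I \<and> K \<subseteq> (\<Union>i\<in>I. ball (h i) e)"
proof -
  have "\<exists>F. finite F \<and> F \<subseteq> K \<and> K \<subseteq> (\<Union>x\<in>F. ball x (1 / Suc m))" for m
    using seq_compact_imp_totally_bounded[of K] assms(1)
    by (simp add: compact_imp_seq_compact)
  then obtain F where F: "\<And>m. finite (F m)" "\<And>m. F m \<subseteq> K"
      "\<And>m. K \<subseteq> (\<Union>x\<in>F m. ball x (1 / Suc m))"
    by metis
  \<comment> \<open>Collecting finite nets of every fineness gives a countable set; one enumeration
    of it then contains, for each \<open>e\<close>, a finite \<open>e\<close>-net.\<close>
  define S where "S = (\<Union>m. F m)"
  have S: "countable S" "S \<subseteq> K" "S \<noteq> {}"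
    using F assms(2) by (auto simp: S_def countable_finite)
  have range: "range (from_nat_into S) = S"
    using S by (simp add: range_from_nat_into)
  show ?thesis
  proof (rule that[of "from_nat_into S"])
    show "range (from_nat_into S) \<subseteq> K" using range S by simp
    fix e :: real assume "e > 0"
    then obtain m where m: "1 / Suc m < e"
      using nat_approx_posE by metis
    have "F m \<subseteq> from_nat_into S ` UNIV" unfolding range by (auto simp: S_def)
    then obtain I where I: "finite I" "F m = from_nat_into S ` I"
      using finite_subset_image[OF F(1)] by metis
    have "K \<subseteq> (\<Union>i\<in>I. ball (from_nat_into S i) e)"
    proof
      fix k assume "k \<in> K"
      then obtain x where "x \<in> F m" "dist x k < 1 / Suc m" using F(3)[of m] by auto
      then show "k \<in> (\<Union>i\<in>I. ball (from_nat_into S i) e)"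
        using m unfolding I(2) by (auto intro: less_trans)
    qed
    then show "\<exists>I. finite I \<and> K \<subseteq> (\<Union>i\<in>I. ball (from_nat_into S i) e)"
      using I by blast
  qed
qed

text \<open>Rescales into the unit ball; the added 1 avoids a case distinction at 0.\<close>

lemma norm_rescale_le:
  fixes x :: "'a::real_normed_vector"
  shows "inverse (norm x + 1) > 0" "norm (inverse (norm x + 1) *\<^sub>R x) \<le> 1"
proof -
  have "norm x + 1 > 0" by (simp add: add_nonneg_pos)
  then show "inverse (norm x + 1) > 0" "norm (inverse (norm x + 1) *\<^sub>R x) \<le> 1"
    by (simp_all add: field_simps)
qed

lemma obtain_mult_le:
  fixes r e :: real
  assumes "r \<ge> 0" "e > 0"
  obtains d where "d > 0" "r * d \<le> e"
proof
  show "e / (r + 1) > 0" "r * (e / (r + 1)) \<le> e"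
    using assms by (simp_all add: add_nonneg_pos divide_simps algebra_simps)
qed

lemma closed_submoduleD:
  assumes "closed_submodule A act W"
  shows "closed W" "0 \<in> W" "x \<in> W \<Longrightarrow> y \<in> W \<Longrightarrow> x + y \<in> W" "x \<in> W \<Longrightarrow> c *\<^sub>C x \<in> W"
    "x \<in> W \<Longrightarrow> a \<in> A \<Longrightarrow> act x a \<in> W" "x \<in> W \<Longrightarrow> y \<in> W \<Longrightarrow> x - y \<in> W"
    "x \<in> W \<Longrightarrow> r *\<^sub>R x \<in> W"
proof -
  show *: "closed W" "0 \<in> W" "x \<in> W \<Longrightarrow> y \<in> W \<Longrightarrow> x + y \<in> W" "x \<in> W \<Longrightarrow> c *\<^sub>C x \<in> W"
    "x \<in> W \<Longrightarrow> a \<in> A \<Longrightarrow> act x a \<in> W" for x y c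
    using assms unfolding closed_submodule_def by blast+
  show "x \<in> W \<Longrightarrow> r *\<^sub>R x \<in> W" for x
    using *(4)[of x "of_real r"] by (simp add: scaleC_of_real)
  show "x \<in> W \<Longrightarrow> y \<in> W \<Longrightarrow> x - y \<in> W" for x y
    using *(3)[of x "(-1) *\<^sub>C y"] *(4)[of y "-1"] by (simp add: scaleC_minus1)
qed

context hilbert_module
begin

section \<open>The Cauchy--Schwarz inequality\<close>

lemma A_closed:
  "closed A" "0 \<in> A" "a \<in> A \<Longrightarrow> b \<in> A \<Longrightarrow> a + b \<in> A" "a \<in> A \<Longrightarrow> b \<in> A \<Longrightarrow> a - b \<in> A"
  "a \<in> A \<Longrightarrow> b \<in> A \<Longrightarrow> a o\<^sub>L b \<in> A"
proof -
  show *: "closed A" "0 \<in> A" "a \<in> A \<Longrightarrow> b \<in> A \<Longrightarrow> a + b \<in> A" "a \<in> A \<Longrightarrow> b \<in> A \<Longrightarrow> a o\<^sub>L b \<in> A" for a b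
    using algebra unfolding compact_operator_algebra_def by blast+
  show "a \<in> A \<Longrightarrow> b \<in> A \<Longrightarrow> a - b \<in> A"
    using *(3)[of a "(-1) *\<^sub>C b"] algebra
    unfolding compact_operator_algebra_def by (metis diff_conv_add_uminus scaleC_minus1)
qed

text \<open>Conjugate symmetry of \<open>ip\<close>, tested on vectors of H. It transfers the
  axioms, stated for the second variable, to the first.\<close>

lemma cinner_ip: "cinner h (ip x y k) = cinner (ip y x h) k"
  using ip_adjoint[of y x] unfolding is_operator_adjoint_def by simp

lemma ip_scaleR_right: "ip x (r *\<^sub>R y) = r *\<^sub>R ip x y"
  by (metis ip_scaleC_right scaleC_of_real)

lemma ip_diff_right: "ip x (y - z) = ip x y - ip x z"
  using ip_add_right[of x "y - z" z] by (simp add: eq_diff_eq)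

lemma ip_add_left: "ip (x + y) z = ip x z + ip y z"
  by (rule blinfun_eqI, rule cinner_ext)
    (simp add: cinner_ip ip_add_right blinfun.add_left cinner_add_left cinner_add_right)

lemma ip_diff_left: "ip (x - y) z = ip x z - ip y z"
  using ip_add_left[of "x - y" y z] by (simp add: eq_diff_eq)

lemma ip_scaleR_left: "ip (r *\<^sub>R x) z = r *\<^sub>R ip x z"
  by (rule blinfun_eqI, rule cinner_ext)
    (simp add: cinner_ip ip_scaleR_right blinfun.scaleR_left cinner_scaleR_left cinner_scaleR_right)

lemma ip_zero_right: "ip x 0 = 0"
  using ip_diff_right[of x 0 0] by simp

lemma ip_zero_left: "ip 0 x = 0"
  using ip_diff_left[of 0 0 x] by simp

lemma ip_zero_commute: "ip x y = 0 \<Longrightarrow> ip y x = 0"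
  by (rule blinfun_eqI, rule cinner_ext) (metis cinner_ip zero_blinfun.rep_eq cinner_add_left
      cinner_add_right add_cancel_right_left)

lemma cinner_ip_act_left: "a \<in> A \<Longrightarrow> cinner h (ip (act x a) y k) = cinner (a h) (ip x y k)"
  by (simp add: cinner_ip ip_act_right)

lemma norm_power2: "(norm x)\<^sup>2 = norm (ip x x)"
  by (simp add: norm_eq[of x])

lemma ip_self_eq_0: "ip x x = 0 \<Longrightarrow> x = 0"
  using norm_power2[of x] by simp

lemma ip_ext:
  assumes "\<And>z. ip z x = ip z y"
  shows "x = y"
  using assms ip_self_eq_0[of "x - y"] by (simp add: ip_diff_right)

lemma act_diff_left: "a \<in> A \<Longrightarrow> act (x - y) a = act x a - act y a"
  using act_add_left[of a "x - y" y] by (simp add: eq_diff_eq)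

lemma act_diff_right: "a \<in> A \<Longrightarrow> b \<in> A \<Longrightarrow> act x (a - b) = act x a - act x b"
  using act_add_right[of "a - b" b x] A_closed by (simp add: eq_diff_eq)

text \<open>\<open>Q u h\<close> is the squared norm of \<open>u \<otimes> h\<close> in the Hilbert space \<open>E \<otimes>\<^sub>A H\<close>.\<close>

definition Q :: "'e \<Rightarrow> 'h \<Rightarrow> real" where
  "Q u h = Re (cinner h (ip u u h))"

lemma Q_nonneg: "0 \<le> Q u h"
  using ip_positive[of u] unfolding positive_operator_def Q_def
  by (auto simp: nonneg_Reals_def dest!: spec[of _ h])

lemma Q_le: "Q u h \<le> (norm u)\<^sup>2 * (norm h)\<^sup>2"
proof -
  have "Q u h \<le> cmod (cinner h (ip u u h))"
    unfolding Q_def by (rule complex_Re_le_cmod)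
  also have "\<dots> \<le> norm h * norm (ip u u h)" by (rule cinner_Cauchy_Schwarz)
  also have "\<dots> \<le> norm h * (norm (ip u u) * norm h)"
    by (intro mult_left_mono norm_blinfun) simp
  finally show ?thesis by (simp add: norm_power2 power2_eq_square[of "norm h"] mult_ac)
qed

lemma Q_act: "a \<in> A \<Longrightarrow> Q (act u a) h = Q u (a h)"
  by (simp add: Q_def cinner_ip_act_left ip_act_right)

lemma Q_parallelogram: "Q (u + v) h + Q (u - v) h = 2 * Q u h + 2 * Q v h"
  by (simp add: Q_def ip_add_left ip_add_right ip_diff_left ip_diff_right
      blinfun.add_left blinfun.diff_left cinner_add_right cinner_diff_right)

lemma Q_scaleR: "Q (r *\<^sub>R u) h = r\<^sup>2 * Q u h"
  by (simp add: Q_def ip_scaleR_left ip_scaleR_right blinfun.scaleR_left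
      cinner_scaleR_right power2_eq_square)

lemma Q_scaleR_vector: "Q u (r *\<^sub>R h) = r\<^sup>2 * Q u h"
  by (simp add: Q_def blinfun.scaleR_right cinner_scaleR_left cinner_scaleR_right power2_eq_square)

lemma Q_add_vector_le: "Q u (h + k) \<le> 2 * Q u h + 2 * Q u k"
proof -
  have "Q u (h + k) + Q u (h - k) = 2 * Q u h + 2 * Q u k"
    by (simp add: Q_def blinfun.add_right blinfun.diff_right cinner_add_right cinner_diff_right
        cinner_add_left cinner_diff_left)
  then show ?thesis using Q_nonneg[of u "h - k"] by linarith
qed

lemma Q_subtract_rank_one:
  "Q (u - act v (ip v u)) h = Q u h - 2 * (norm (ip v u h))\<^sup>2 + Q v (ip v u h)"
  by (simp add: Q_def ip_diff_left ip_diff_right blinfun.diff_left cinner_diff_right ip_in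
      cinner_ip_act_left ip_act_right cinner_self cinner_ip[of h u v])

text \<open>Here \<open>act v (ip v u)\<close> is the rank one operator of v applied to u. In the
  expansion of \<open>Q\<close>, the last term cancels at most one of the two subtracted copies of
  the square. Since \<open>Q\<close> is nonnegative this yields the Cauchy-Schwarz inequality; later
  it supplies better competitors in the minimisation.\<close>

lemma Q_decrease:
  assumes "norm v \<le> 1"
  shows "Q (u - act v (ip v u)) h \<le> Q u h - (norm (ip v u h))\<^sup>2"
proof -
  have "Q v (ip v u h) \<le> (norm v)\<^sup>2 * (norm (ip v u h))\<^sup>2" by (rule Q_le)
  also have "\<dots> \<le> 1 * (norm (ip v u h))\<^sup>2"
    using assms by (intro mult_right_mono) (auto simp: power_le_one)
  finally show ?thesis unfolding Q_subtract_rank_one by simp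
qed

lemma Cauchy_Schwarz_Q: "(norm (ip v u h))\<^sup>2 \<le> (norm v)\<^sup>2 * Q u h"
proof (cases "v = 0")
  case True
  then show ?thesis by (simp add: ip_zero_left)
next
  case False
  define v' where "v' = inverse (norm v) *\<^sub>R v"
  have "norm v' \<le> 1" using False by (simp add: v'_def)
  from Q_decrease[OF this, of u h] Q_nonneg[of "u - act v' (ip v' u)" h]
  have "(norm (ip v' u h))\<^sup>2 \<le> Q u h" by linarith
  then show ?thesis
    using False
    by (simp add: v'_def ip_scaleR_left blinfun.scaleR_left divide_simps power_mult_distrib
        mult.commute)
qed

lemma norm_ip_apply_le: "norm (ip v u h) \<le> norm v * norm u * norm h"
proof -
  have "(norm (ip v u h))\<^sup>2 \<le> (norm v)\<^sup>2 * ((norm u)\<^sup>2 * (norm h)\<^sup>2)"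
    using Cauchy_Schwarz_Q[of v u h] mult_left_mono[OF Q_le[of u h], of "(norm v)\<^sup>2"] by simp
  then have "(norm (ip v u h))\<^sup>2 \<le> (norm v * norm u * norm h)\<^sup>2"
    by (simp add: power_mult_distrib mult_ac)
  then show ?thesis by (rule power2_le_imp_le) simp
qed

lemma norm_ip_le: "norm (ip v u) \<le> norm v * norm u"
  by (rule norm_blinfun_bound) (auto simp: norm_ip_apply_le)

lemma bounded_linear_ip: "bounded_linear (ip v)"
  by (rule bounded_linear_intro[where K = "norm v"])
    (simp_all add: ip_add_right ip_scaleR_right norm_ip_le mult.commute[of _ "norm v"])

text \<open>The norm of the positive operator <y,y> is controlled by its quadratic form:
  Cauchy-Schwarz bounds |<y,y>h| by |y| sqrt(c) |h|, hence |y|^2 by |y| sqrt(c), and one factor |y|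
  cancels.\<close>

lemma norm_le_Q:
  assumes Q: "\<And>h. norm h \<le> 1 \<Longrightarrow> Q y h \<le> c"
  shows "(norm y)\<^sup>2 \<le> c"
proof (cases "y = 0")
  case True
  then show ?thesis using Q[of 0] Q_nonneg[of y 0] by simp
next
  case False
  have c: "c \<ge> 0" using Q[of 0] Q_nonneg[of y 0] by simp
  have Qc: "Q y h \<le> c * (norm h)\<^sup>2" for h
  proof (cases "h = 0")
    case True
    then show ?thesis using Q_le[of y h] by simp
  next
    case False
    then show ?thesis
      using Q[of "inverse (norm h) *\<^sub>R h"]
      by (simp add: Q_scaleR_vector divide_simps)
  qed
  have "norm (ip y y) \<le> norm y * sqrt c"
  proof (rule norm_blinfun_bound)
    show "norm (ip y y h) \<le> norm y * sqrt c * norm h" for h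
    proof (rule power2_le_imp_le)
      have "(norm (ip y y h))\<^sup>2 \<le> (norm y)\<^sup>2 * Q y h" by (rule Cauchy_Schwarz_Q)
      also have "\<dots> \<le> (norm y)\<^sup>2 * (c * (norm h)\<^sup>2)" by (intro mult_left_mono Qc) simp
      also have "\<dots> = (norm y * sqrt c * norm h)\<^sup>2" using c by (simp add: power_mult_distrib)
      finally show "(norm (ip y y h))\<^sup>2 \<le> (norm y * sqrt c * norm h)\<^sup>2" .
    qed (use c in simp)
  qed (use c in simp)
  then have "norm y * norm y \<le> norm y * sqrt c"
    by (simp add: norm_power2[symmetric] power2_eq_square)
  then have "norm y \<le> sqrt c" using False by simp
  then show ?thesis using c by (metis norm_ge_zero power_mono real_sqrt_pow2)
qed

section \<open>Orthogonal complements\<close>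

definition orth :: "'e set \<Rightarrow> 'e set" where
  "orth S = {x. \<forall>s\<in>S. ip s x = 0}"

lemma closed_submodule_orth: "closed_submodule A act (orth S)"
proof -
  have "closed {x. ip s x = 0}" for s
    by (intro closed_Collect_eq continuous_on_const
        linear_continuous_on bounded_linear_ip)
  then have "closed (\<Inter>s\<in>S. {x. ip s x = 0})" by blast
  moreover have "orth S = (\<Inter>s\<in>S. {x. ip s x = 0})" by (auto simp: orth_def)
  moreover have "c *\<^sub>C (0 :: 'h \<Rightarrow>\<^sub>L 'h) = 0" for c
    using norm_scaleC[of c "0 :: 'h \<Rightarrow>\<^sub>L 'h"] by simp
  ultimately show ?thesis
    unfolding closed_submodule_def
    by (auto simp: orth_def ip_add_right ip_scaleC_right ip_act_right ip_zero_right)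
qed

lemma subset_orth_orth: "S \<subseteq> orth (orth S)"
  unfolding orth_def using ip_zero_commute by blast

lemma is_adjoint_commute: "is_adjoint ip T' T \<Longrightarrow> is_adjoint ip T T'"
  unfolding is_adjoint_def
  by (intro allI blinfun_eqI, rule cinner_ext) (simp add: cinner_ip)

text \<open>The fixed points of S are the complement of the range of S* - I, so closedness follows
  without continuity of S.\<close>

lemma closed_submodule_fixed_points:
  assumes "S \<in> adjointable_operators ip"
  shows "closed_submodule A act {x. S x = x}"
proof -
  obtain S' where S': "is_adjoint ip S S'"
    using assms is_adjoint_commute unfolding adjointable_operators_def by blast
  have "{x. S x = x} = orth (range (\<lambda>y. S' y - y))"
  proof -
    have "ip (S' y - y) x = ip y (S x) - ip y x" for x y
      using S' by (simp add: is_adjoint_def ip_diff_left)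
    then show ?thesis by (auto simp: orth_def intro: ip_ext)
  qed
  then show ?thesis using closed_submodule_orth by simp
qed

lemma norm_le_if_orthogonal:
  assumes "ip w (z - w) = 0"
  shows "norm w \<le> norm z"
proof (cases "w = 0")
  case False
  have "ip w w = ip w z" using assms by (simp add: ip_diff_right)
  then have "norm w * norm w \<le> norm w * norm z"
    using norm_ip_le[of w z] norm_power2[of w] by (simp add: power2_eq_square)
  then show ?thesis using False by simp
qed simp

text \<open>The algebraic sum of W and its orthogonal complement.\<close>

definition complemented_part :: "'e set \<Rightarrow> 'e set" where
  "complemented_part W = {x. \<exists>w\<in>W. x - w \<in> orth W}"

text \<open>The component in W depends contractively on the vector, so the components of a
  convergent sequence are Cauchy, and both limits stay in their closed submodules.\<close>

lemma closed_complemented_part: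
  assumes W: "closed_submodule A act W"
  shows "closed (complemented_part W)"
  unfolding closed_sequential_limits
proof (intro allI impI, elim conjE)
  fix x l assume x: "\<forall>n. x n \<in> complemented_part W" and lim: "x \<longlonglongrightarrow> l"
  note O = closed_submodule_orth[of W]
  have "\<forall>n. \<exists>w. w \<in> W \<and> x n - w \<in> orth W"
    using x unfolding complemented_part_def by blast
  then obtain w where w: "\<And>n. w n \<in> W" "\<And>n. x n - w n \<in> orth W" by metis
  have "norm (w n - w m) \<le> norm (x n - x m)" for n m
  proof (rule norm_le_if_orthogonal)
    have "x n - x m - (w n - w m) = (x n - w n) - (x m - w m)" by simp
    then have "x n - x m - (w n - w m) \<in> orth W"
      using closed_submoduleD(6)[OF O w(2)[of n] w(2)[of m]] by metis
    then show "ip (w n - w m) (x n - x m - (w n - w m)) = 0"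
      using closed_submoduleD(6)[OF W w(1) w(1)] unfolding orth_def by blast
  qed
  moreover have "Cauchy x" using lim by (rule LIMSEQ_imp_Cauchy)
  ultimately have "Cauchy w" unfolding Cauchy_iff by (meson le_less_trans)
  then obtain v where v: "w \<longlonglongrightarrow> v" using Cauchy_convergent convergent_def by blast
  have "v \<in> W"
    using closed_sequentially[OF closed_submoduleD(1)[OF W]] w(1) v by blast
  moreover have "l - v \<in> orth W"
    by (rule closed_sequentially[OF closed_submoduleD(1)[OF O] w(2) tendsto_diff[OF lim v]])
  ultimately show "l \<in> complemented_part W" unfolding complemented_part_def by blast
qed

section \<open>Approximate units\<close>

text \<open>With \<open>a = <x,x>\<close> and \<open>s\<^sub>n = (1 - a)\<^sup>n h\<close>, the numbers \<open><s\<^sub>n, a s\<^sub>n>\<close> decrease and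
  are bounded by \<open>|s\<^sub>n|\<^sup>2 - |s\<^sub>n\<^sub>+\<^sub>1|\<^sup>2\<close>, so they are at most \<open>|h|\<^sup>2 / n\<close>.\<close>

lemma Q_iterate_le:
  assumes x: "norm x \<le> 1"
  defines "f \<equiv> \<lambda>h. h - ip x x h"
  shows "real n * Q x ((f ^^ n) h) + (norm ((f ^^ n) h))\<^sup>2 \<le> (norm h)\<^sup>2"
proof (induction n)
  case 0
  then show ?case by simp
next
  case (Suc n)
  define s where "s = (f ^^ n) h"
  define g where "g = ip x x s"
  have f: "(f ^^ Suc n) h = s - g" by (simp add: s_def g_def f_def)
  have x1: "(norm x)\<^sup>2 \<le> 1" using x by (simp add: power_le_one)
  have g: "(norm g)\<^sup>2 \<le> Q x s"
    using Cauchy_Schwarz_Q[of x x s] mult_right_mono[OF x1 Q_nonneg[of x s]] by (simp add: g_def)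
  have Qg: "Q x g \<le> (norm g)\<^sup>2"
    using Q_le[of x g] mult_right_mono[OF x1, of "(norm g)\<^sup>2"] by simp
  have "complex_of_real ((norm (s - g))\<^sup>2)
      = (norm s)\<^sup>2 - cinner s g - cnj (cinner s g) + (norm g)\<^sup>2"
    unfolding cinner_self[symmetric]
    by (simp add: cinner_diff_left cinner_diff_right cinner_commute[of g s])
  from arg_cong[OF this, of Re]
  have norm: "(norm (s - g))\<^sup>2 = (norm s)\<^sup>2 - 2 * Q x s + (norm g)\<^sup>2"
    by (simp add: Q_def g_def)
  have "Q x (s - g) = Q x s - 2 * (norm g)\<^sup>2 + Q x g"
  proof -
    have "cinner s (ip x x g) = cinner g g" by (simp add: cinner_ip g_def)
    moreover have "Re (cinner g (ip x x s)) = (norm g)\<^sup>2"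
      by (simp add: cinner_self flip: g_def)
    ultimately show ?thesis
      by (simp add: Q_def blinfun.diff_right cinner_diff_left cinner_diff_right cinner_self)
  qed
  then have dec: "Q x (s - g) \<le> Q x s" using Qg zero_le_power2[of "norm g"] by linarith
  have "real (Suc n) * Q x (s - g) + (norm (s - g))\<^sup>2
      \<le> real (Suc n) * Q x s + (norm (s - g))\<^sup>2"
    using dec by (simp add: mult_left_mono)
  \<comment> \<open>As |g|^2 is at most \<open>Q x s\<close>, the drop from |s|^2 to |s - g|^2 is at
    least \<open>Q x s\<close>, which pays for the extra copy.\<close>
  also have "\<dots> \<le> real n * Q x s + (norm s)\<^sup>2"
    unfolding norm using g by (simp add: algebra_simps)
  also have "\<dots> \<le> (norm h)\<^sup>2" using Suc by (simp add: s_def)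
  finally show ?case unfolding f .
qed

text \<open>The polynomial 1 - (1 - t)^n has no constant term, so its value at a = <x,x> is some b
  in A, and x - x b = x(1 - a)^n tends to 0 by \<open>Q_iterate_le\<close>.\<close>

lemma in_closure_act_range:
  assumes x: "norm x \<le> 1"
  shows "x \<in> closure (act x ` A)"
proof -
  define a where "a = ip x x"
  define f where "f = (\<lambda>h. h - a h)"
  have a: "a \<in> A" by (simp add: a_def ip_in)
  have "\<exists>b\<in>A. \<forall>h. Q (x - act x b) h = Q x ((f ^^ n) h)" for n
  proof (induction n)
    case 0
    have "act x 0 = 0" using act_diff_right[of 0 0 x] A_closed by simp
    then show ?case using A_closed by (intro bexI[of _ 0]) auto
  next
    case (Suc n)
    then obtain b where b: "b \<in> A" "\<And>h. Q (x - act x b) h = Q x ((f ^^ n) h)" by blast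
    define y where "y = x - act x b"
    \<comment> \<open>The new coefficient comes from 1 - (b + a - ba) = (1 - b)(1 - a).\<close>
    have "x - act x (b + (a - (b o\<^sub>L a))) = y - act y a"
      using a b by (simp add: y_def act_add_right act_diff_right act_diff_left act_mult A_closed)
    moreover have "Q (y - act y a) h = Q y (f h)" for h
      using a by (simp add: Q_def ip_diff_left ip_diff_right blinfun.diff_left
          blinfun.diff_right cinner_diff_left cinner_diff_right cinner_ip_act_left ip_act_right f_def)
    ultimately show ?case
      using a b(1) A_closed b(2)
      by (intro bexI[of _ "b + (a - (b o\<^sub>L a))"])
        (simp_all add: y_def[symmetric] funpow_Suc_right del: funpow.simps)
  qed
  then obtain b where b: "\<And>n. b n \<in> A" "\<And>n h. Q (x - act x (b n)) h = Q x ((f ^^ n) h)"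
    by metis
  have bound: "(norm (x - act x (b (Suc n))))\<^sup>2 \<le> inverse (real (Suc n))" for n
  proof (rule norm_le_Q)
    fix h :: 'h assume "norm h \<le> 1"
    then have "(norm h)\<^sup>2 \<le> 1" by (simp add: power_le_one)
    then have "real (Suc n) * Q x ((f ^^ Suc n) h) + (norm ((f ^^ Suc n) h))\<^sup>2 \<le> 1"
      using Q_iterate_le[OF x, of "Suc n" h] unfolding f_def a_def by linarith
    then have "real (Suc n) * Q x ((f ^^ Suc n) h) \<le> 1"
      using zero_le_power2[of "norm ((f ^^ Suc n) h)"] by linarith
    then show "Q (x - act x (b (Suc n))) h \<le> inverse (real (Suc n))"
      unfolding b(2) by (simp add: field_simps del: funpow.simps)
  qed
  have "(\<lambda>n. (norm (x - act x (b (Suc n))))\<^sup>2) \<longlonglongrightarrow> 0"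
    by (rule tendsto_sandwich[OF _ _ tendsto_const LIMSEQ_inverse_real_of_nat])
      (use bound in auto)
  then have "(\<lambda>n. norm (act x (b (Suc n)) - x)) \<longlonglongrightarrow> 0"
    using tendsto_real_sqrt by (fastforce simp: norm_minus_commute)
  then have "(\<lambda>n. act x (b (Suc n))) \<longlonglongrightarrow> x"
    by (rule LIM_zero_cancel[OF tendsto_norm_zero_cancel])
  then show ?thesis
    unfolding closure_sequential using b(1) by (intro exI[of _ "\<lambda>n. act x (b (Suc n))"]) simp
qed

section \<open>Complements of closed submodules\<close>

text \<open>Elements \<open>x\<close> of norm at most 1 are limits of \<open>x b\<close> with \<open>b \<in> A\<close>, so it suffices to split
  \<open>x b\<close>. Among the \<open>u \<in> x + W\<close> with \<open><u,u> \<le> <x,x>\<close>, take a minimising sequence for a weighted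
  sum \<open>N\<close> of the \<open>Q u (h i)\<close>, where the \<open>h i\<close> are dense in the image of the unit ball
  under \<open>b\<close>. The constraint keeps the sequence bounded in norm, so by compactness of \<open>b\<close> the
  sequence \<open>u\<^sub>n b\<close> converges in norm. The constraint is preserved by \<open>u \<mapsto> u - v <v,u>\<close> for
  \<open>v \<in> W\<close>, \<open>|v| \<le> 1\<close>, so minimality makes the limit orthogonal to \<open>W\<close>.\<close>

lemma act_in_complemented_part:
  assumes W: "closed_submodule A act W" and b: "b \<in> A"
  shows "act x b \<in> complemented_part W"
proof -
  define K where "K = closure (blinfun_apply b ` cball 0 1)"
  have "compact K"
    using b algebra unfolding compact_operator_algebra_def compact_operators_def K_def by blast
  moreover have bK: "b z \<in> K" if "norm z \<le> 1" for z
    using that closure_subset[of "blinfun_apply b ` cball 0 1"] unfolding K_def by auto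
  moreover have "K \<noteq> {}" using bK[of 0] by auto
  ultimately obtain h :: "nat \<Rightarrow> 'h" where hK: "range h \<subseteq> K"
    and h: "\<And>e. e > 0 \<Longrightarrow> \<exists>I. finite I \<and> K \<subseteq> (\<Union>i\<in>I. ball (h i) e)"
    using compact_dense_sequence by metis
  obtain M where M: "\<And>z. z \<in> K \<Longrightarrow> norm z \<le> M"
    using compact_imp_bounded[OF \<open>compact K\<close>] unfolding bounded_iff by blast

  \<comment> \<open>\<open>N\<close> is a squared Hilbert seminorm: the weights make it finite
    because the \<open>h i\<close> are bounded, and it inherits the parallelogram law from
    \<open>Q\<close>.\<close>
  define N where "N = (\<lambda>u. \<Sum>i. (1/2)^i * Q u (h i))"
  have summable_N: "summable (\<lambda>i. (1/2)^i * Q u (h i))" for u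
  proof (rule summable_comparison_test')
    show "summable (\<lambda>i. (1/2)^i * ((norm u)\<^sup>2 * M\<^sup>2))"
      by (intro summable_mult2 summable_geometric) simp
    fix i :: nat
    have "norm (h i) \<le> M" using M hK by blast
    then have "(norm u)\<^sup>2 * (norm (h i))\<^sup>2 \<le> (norm u)\<^sup>2 * M\<^sup>2"
      by (intro mult_left_mono power_mono) auto
    then show "norm ((1/2)^i * Q u (h i)) \<le> (1/2)^i * ((norm u)\<^sup>2 * M\<^sup>2)"
      using Q_le[of u "h i"] Q_nonneg[of u "h i"] by (simp add: abs_mult)
  qed
  have sums_N: "(\<lambda>i. (1/2)^i * Q u (h i)) sums N u" for u
    unfolding N_def using summable_N by (rule summable_sums)
  have N_nonneg: "0 \<le> N u" for u
    unfolding N_def by (intro suminf_nonneg summable_N) (simp add: Q_nonneg)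
  have N_term: "Q u (h i) \<le> 2^i * N u" for u i
  proof -
    have "(\<Sum>i\<in>{i}. (1/2)^i * Q u (h i)) \<le> N u"
      unfolding N_def by (intro sum_le_suminf summable_N) (auto simp: Q_nonneg)
    then show ?thesis by (simp add: field_simps)
  qed
  have N_parallelogram: "N (u + v) + N (u - v) = 2 * N u + 2 * N v" for u v
  proof -
    have "(1/2)^i * Q (u + v) (h i) + (1/2)^i * Q (u - v) (h i)
        = 2 * ((1/2)^i * Q u (h i)) + 2 * ((1/2)^i * Q v (h i))" for i
      using arg_cong[OF Q_parallelogram[of u v "h i"], of "\<lambda>q. (1/2)^i * q"]
      by (simp only: distrib_left mult.left_commute)
    then show ?thesis
      using sums_add[OF sums_N[of "u + v"] sums_N[of "u - v"]]
        sums_add[OF sums_mult[OF sums_N[of u], of 2] sums_mult[OF sums_N[of v], of 2]]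
      by (simp add: sums_unique2)
  qed
  have N_scaleR: "N (r *\<^sub>R u) = r\<^sup>2 * N u" for r u
  proof -
    have "(\<lambda>i. r\<^sup>2 * ((1/2)^i * Q u (h i))) sums N (r *\<^sub>R u)"
      using sums_N[of "r *\<^sub>R u"] by (simp only: Q_scaleR mult.left_commute)
    then show ?thesis using sums_mult[OF sums_N[of u], of "r\<^sup>2"] by (rule sums_unique2)
  qed

  define C where "C = {u. x - u \<in> W \<and> (\<forall>k. Q u k \<le> Q x k)}"
  have norm_C: "norm u \<le> norm x" if "u \<in> C" for u
  proof -
    have "(norm u)\<^sup>2 \<le> (norm x)\<^sup>2"
    proof (rule norm_le_Q)
      fix k :: 'h assume "norm k \<le> 1"
      then have "(norm x)\<^sup>2 * (norm k)\<^sup>2 \<le> (norm x)\<^sup>2"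
        by (intro mult_left_le) (auto simp: power_le_one)
      then show "Q u k \<le> (norm x)\<^sup>2"
        using that Q_le[of x k] unfolding C_def by (auto intro: order_trans)
    qed
    then show ?thesis by (rule power2_le_imp_le) simp
  qed
  have midpoint: "(1/2) *\<^sub>R (u + v) \<in> C" if "u \<in> C" "v \<in> C" for u v
  proof -
    have "x - (1/2) *\<^sub>R (u + v) = (1/2) *\<^sub>R ((x - u) + (x - v))"
      by (simp add: scaleR_add_right scaleR_diff_right flip: scaleR_add_left)
    then have "x - (1/2) *\<^sub>R (u + v) \<in> W"
      using that closed_submoduleD(3,7)[OF W] unfolding C_def by simp
    moreover have "Q ((1/2) *\<^sub>R (u + v)) k \<le> Q x k" for k
    proof -
      have "Q u k \<le> Q x k" "Q v k \<le> Q x k" using that unfolding C_def by auto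
      then show ?thesis
        using Q_parallelogram[of u v k] Q_nonneg[of "u - v" k]
        by (simp add: Q_scaleR power2_eq_square)
    qed
    ultimately show ?thesis unfolding C_def by blast
  qed

  define m where "m = Inf (N ` C)"
  have m: "m \<le> N u" if "u \<in> C" for u
    unfolding m_def using that N_nonneg by (intro cINF_lower bdd_belowI2[of _ 0]) auto
  have "x \<in> C" using closed_submoduleD(2)[OF W] unfolding C_def by simp
  then have "\<exists>u\<in>C. N u < m + inverse (real (Suc n))" for n
    using cInf_lessD[of "N ` C" "m + inverse (real (Suc n))"] unfolding m_def by auto
  then obtain u where u: "\<And>n. u n \<in> C" "\<And>n. N (u n) < m + inverse (real (Suc n))" by metis
  \<comment> \<open>Midpoints stay in \<open>C\<close>, so \<open>N (u n + u k)\<close> is at least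
    4m, and the parallelogram law makes the minimising sequence Cauchy for \<open>N\<close>.\<close>
  have N_diff: "N (u n - u k) \<le> 4 * inverse (real (Suc l))" if "n \<ge> l" "k \<ge> l" for n k l
  proof -
    have "4 * m \<le> N (u n + u k)"
      using m[OF midpoint[OF u(1)[of n] u(1)[of k]]] unfolding N_scaleR
      by (simp add: power2_eq_square)
    moreover have "inverse (real (Suc n)) \<le> inverse (real (Suc l))"
      "inverse (real (Suc k)) \<le> inverse (real (Suc l))"
      using that by (simp_all add: le_imp_inverse_le)
    ultimately show ?thesis
      using N_parallelogram[of "u n" "u k"] u(2)[of n] u(2)[of k] by linarith
  qed

  have "Cauchy (\<lambda>n. act (u n) b)"
    unfolding Cauchy_iff
  proof (intro allI impI)
    fix e :: real assume e: "e > 0"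
    \<comment> \<open>A finite d-net of K reduces the estimate to finitely many \<open>h i\<close>,
      where \<open>N\<close> controls \<open>Q\<close>. As |w| is at most 2|x|, the net error
      contributes at most (e/3)^2, and 2(1/8 + 1/9) < 1/2.\<close>
    obtain d where d: "d > 0" and xd: "norm x * d \<le> e / 6"
      using e by (auto intro: obtain_mult_le[of "norm x" "e / 6"])
    obtain I where I: "finite I" "K \<subseteq> (\<Union>i\<in>I. ball (h i) d)" using h[OF d] by blast
    define L where "L = (\<Sum>i\<in>I. (2::real)^i)"
    have L: "2^i \<le> L" if "i \<in> I" for i
      unfolding L_def using I(1) that by (intro member_le_sum) auto
    have "L \<ge> 0" unfolding L_def by (intro sum_nonneg) simp
    have "(\<lambda>l. 4 * L * inverse (real (Suc l))) \<longlonglongrightarrow> 4 * L * 0"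
      by (intro tendsto_mult tendsto_const LIMSEQ_inverse_real_of_nat)
    then have "\<forall>\<^sub>F l in sequentially. 4 * L * inverse (real (Suc l)) < e\<^sup>2 / 8"
      using e by (intro order_tendstoD(2)) auto
    then obtain l where l: "4 * L * inverse (real (Suc l)) < e\<^sup>2 / 8"
      using eventually_happens by fastforce
    show "\<exists>l. \<forall>n\<ge>l. \<forall>k\<ge>l. norm (act (u n) b - act (u k) b) < e"
    proof (intro exI[of _ l] allI impI)
      fix n k assume nk: "n \<ge> l" "k \<ge> l"
      define w where "w = u n - u k"
      have norm_w: "norm w \<le> 2 * norm x"
        using norm_triangle_ineq4[of "u n" "u k"] norm_C[OF u(1)[of n]] norm_C[OF u(1)[of k]]
        by (simp add: w_def)
      have "(norm (act w b))\<^sup>2 \<le> e\<^sup>2 / 2"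
      proof (rule norm_le_Q)
        fix z :: 'h assume "norm z \<le> 1"
        then obtain i where i: "i \<in> I" "dist (h i) (b z) < d" using bK I(2) by force
        have "Q w (h i) \<le> 2^i * N w" by (rule N_term)
        also have "\<dots> \<le> L * (4 * inverse (real (Suc l)))"
          using L[OF i(1)] N_diff[OF nk] N_nonneg[of w] \<open>L \<ge> 0\<close>
          by (intro mult_mono) (auto simp: w_def)
        finally have 1: "Q w (h i) \<le> e\<^sup>2 / 8" using l by simp
        have "norm w * norm (b z - h i) \<le> (2 * norm x) * d"
          using norm_w i(2) by (intro mult_mono) (auto simp: dist_norm norm_minus_commute)
        also have "\<dots> \<le> e / 3" using xd by simp
        finally have "(norm w * norm (b z - h i))\<^sup>2 \<le> (e / 3)\<^sup>2" by (intro power_mono) auto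
        then have 2: "Q w (b z - h i) \<le> e\<^sup>2 / 9"
          using Q_le[of w "b z - h i"] by (simp add: power_mult_distrib power_divide)
        have "Q w (b z) \<le> 2 * Q w (h i) + 2 * Q w (b z - h i)"
          using Q_add_vector_le[of w "h i" "b z - h i"] by simp
        then have "Q w (b z) \<le> e\<^sup>2 / 2" using 1 2 zero_le_power2[of e] by linarith
        then show "Q (act w b) z \<le> e\<^sup>2 / 2" using b by (simp add: Q_act)
      qed
      also have "\<dots> < e\<^sup>2" using e by simp
      finally have "norm (act w b) < e" using e by (simp add: power2_less_imp_less)
      then show "norm (act (u n) b - act (u k) b) < e"
        using b by (simp add: w_def act_diff_left)
    qed
  qed
  then obtain y where y: "(\<lambda>n. act (u n) b) \<longlonglongrightarrow> y" using Cauchy_convergent convergent_def by blast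
  have "act x b - y \<in> W"
  proof (rule closed_sequentially[OF closed_submoduleD(1)[OF W]])
    show "(\<lambda>n. act x b - act (u n) b) \<longlonglongrightarrow> act x b - y"
      by (intro tendsto_diff tendsto_const y)
    show "act x b - act (u n) b \<in> W" for n
      using u(1)[of n] b closed_submoduleD(5)[OF W, of "x - u n" b]
      by (simp add: C_def act_diff_left)
  qed
  moreover have orth: "ip v y z = 0" if v: "v \<in> W" "norm v \<le> 1" and z: "norm z \<le> 1" for v z
  proof -
    have lim0: "(\<lambda>n. ip v (u n) (h i)) \<longlonglongrightarrow> 0" for i
    proof -
      have le: "(norm (ip v (u n) (h i)))\<^sup>2 \<le> 2^i * inverse (real (Suc n))" for n
      proof -
        \<comment> \<open>\<open>u'\<close> competes with \<open>u n\<close> in \<open>C\<close>, so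
          it can lower \<open>N\<close> by at most 1/(n+1). No term of the series increases, hence
          the drop of the i-th term alone obeys this bound.\<close>
        define u' where "u' = u n - act v (ip v (u n))"
        have dec: "Q u' k \<le> Q (u n) k - (norm (ip v (u n) k))\<^sup>2" for k
          unfolding u'_def using v(2) by (rule Q_decrease)
        have Qle: "Q u' k \<le> Q (u n) k" for k
          using dec[of k] zero_le_power2[of "norm (ip v (u n) k)"] by linarith
        have "(x - u n) + act v (ip v (u n)) \<in> W"
          using u(1)[of n] v(1) closed_submoduleD(3,5)[OF W] ip_in unfolding C_def by blast
        then have "u' \<in> C"
          using u(1)[of n] Qle unfolding C_def u'_def
          by (auto intro: order_trans simp: algebra_simps)
        have "(\<Sum>j\<in>{i}. (1/2)^j * Q (u n) (h j) - (1/2)^j * Q u' (h j))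
            \<le> (\<Sum>j. (1/2)^j * Q (u n) (h j) - (1/2)^j * Q u' (h j))"
          using Qle by (intro sum_le_suminf summable_diff summable_N) auto
        also have "\<dots> = N (u n) - N u'"
          unfolding N_def by (intro suminf_diff[symmetric] summable_N)
        also have "\<dots> \<le> inverse (real (Suc n))" using m[OF \<open>u' \<in> C\<close>] u(2)[of n] by linarith
        finally have "Q (u n) (h i) - Q u' (h i) \<le> 2^i * inverse (real (Suc n))"
          by (simp add: field_simps)
        with dec[of "h i"] show ?thesis by linarith
      qed
      have "(\<lambda>n. 2^i * inverse (real (Suc n))) \<longlonglongrightarrow> 2^i * 0"
        by (intro tendsto_mult tendsto_const LIMSEQ_inverse_real_of_nat)
      then have "(\<lambda>n. 2^i * inverse (real (Suc n))) \<longlonglongrightarrow> 0" by simp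
      from tendsto_sandwich[OF _ _ tendsto_const this, of "\<lambda>n. (norm (ip v (u n) (h i)))\<^sup>2"]
      have "(\<lambda>n. (norm (ip v (u n) (h i)))\<^sup>2) \<longlonglongrightarrow> 0" using le by simp
      from tendsto_real_sqrt[OF this] have "(\<lambda>n. norm (ip v (u n) (h i))) \<longlonglongrightarrow> 0" by simp
      then show ?thesis by (rule tendsto_norm_zero_cancel)
    qed
    have lim: "(\<lambda>n. ip v (u n) (b z)) \<longlonglongrightarrow> ip v y z"
    proof -
      have "(\<lambda>n. ip v (act (u n) b)) \<longlonglongrightarrow> ip v y"
        by (rule bounded_linear.tendsto[OF bounded_linear_ip y])
      then have "(\<lambda>n. ip v (act (u n) b) z) \<longlonglongrightarrow> ip v y z"
        by (intro blinfun.tendsto tendsto_const)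
      then show ?thesis using b by (simp add: ip_act_right)
    qed
    \<comment> \<open>The bound on |u n| makes replacing \<open>b z\<close> by a nearby
      \<open>h i\<close> uniform in n, so the limits at the \<open>h i\<close> determine the limit
      at \<open>b z\<close>.\<close>
    have "norm (ip v y z) \<le> e" if e: "e > 0" for e
    proof -
      obtain d where d: "d > 0" and xd: "norm x * d \<le> e"
        using e by (auto intro: obtain_mult_le[of "norm x" e])
      obtain i where i: "dist (h i) (b z) < d" using h[OF d] bK[OF z] by force
      have "norm (ip v (u n) (b z) - ip v (u n) (h i)) \<le> e" for n
      proof -
        have "norm (ip v (u n) (b z - h i)) \<le> norm v * norm (u n) * norm (b z - h i)"
          by (rule norm_ip_apply_le)
        also have "\<dots> \<le> (1 * norm x) * d"
          using i v(2) norm_C[OF u(1)]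
          by (intro mult_mono) (auto simp: dist_norm norm_minus_commute)
        finally show ?thesis using xd by (simp add: blinfun.diff_right)
      qed
      moreover have "(\<lambda>n. norm (ip v (u n) (b z) - ip v (u n) (h i))) \<longlonglongrightarrow> norm (ip v y z - 0)"
        by (intro tendsto_norm tendsto_diff lim lim0)
      ultimately show ?thesis
        using LIMSEQ_le_const2[of _ "norm (ip v y z - 0)" e] by simp
    qed
    then have "norm (ip v y z) \<le> 0" by (rule field_le_epsilon) simp
    then show ?thesis by simp
  qed
  have "y \<in> orth W"
    unfolding orth_def
  proof (intro CollectI ballI blinfun_eqI)
    fix v and z :: 'h assume v: "v \<in> W"
    define r s where "r = inverse (norm v + 1)" and "s = inverse (norm z + 1)"
    have rs: "r > 0" "s > 0" and "norm (r *\<^sub>R v) \<le> 1" "norm (s *\<^sub>R z) \<le> 1"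
      unfolding r_def s_def by (rule norm_rescale_le)+
    then have "ip (r *\<^sub>R v) y (s *\<^sub>R z) = 0"
      using orth[of "r *\<^sub>R v" "s *\<^sub>R z"] closed_submoduleD(7)[OF W v] by blast
    then show "ip v y z = blinfun_apply 0 z"
      using rs by (simp add: ip_scaleR_left blinfun.scaleR_left blinfun.scaleR_right)
  qed
  ultimately show ?thesis
    unfolding complemented_part_def by (intro CollectI bexI[of _ "act x b - y"]) auto
qed

lemma complemented_part_eq_UNIV:
  assumes W: "closed_submodule A act W"
  shows "complemented_part W = UNIV"
proof -
  have "x \<in> complemented_part W" for x
  proof -
    define r where "r = inverse (norm x + 1)"
    have r: "r > 0" "norm (r *\<^sub>R x) \<le> 1"
      unfolding r_def by (rule norm_rescale_le)+
    have "act (r *\<^sub>R x) ` A \<subseteq> complemented_part W"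
      using act_in_complemented_part[OF W] by blast
    then have "closure (act (r *\<^sub>R x) ` A) \<subseteq> complemented_part W"
      by (rule closure_minimal) (rule closed_complemented_part[OF W])
    with in_closure_act_range[OF r(2)] obtain w where w: "w \<in> W" "r *\<^sub>R x - w \<in> orth W"
      unfolding complemented_part_def by blast
    have "x - inverse r *\<^sub>R w = inverse r *\<^sub>R (r *\<^sub>R x - w)"
      using r by (simp add: scaleR_diff_right)
    then show ?thesis
      using closed_submoduleD(7)[OF W w(1)] closed_submoduleD(7)[OF closed_submodule_orth w(2)]
      unfolding complemented_part_def by (intro CollectI bexI[of _ "inverse r *\<^sub>R w"]) simp_all
  qed
  then show ?thesis by blast
qed

text \<open>Choosing a component in W for each vector suffices: orthogonality gives
  self-adjointness, and a vector of W is its own component, which gives idempotence.\<close>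

lemma obtain_projection:
  assumes W: "closed_submodule A act W"
  obtains P where "is_projection ip P" "\<And>x. P x \<in> W" "\<And>x. x \<in> W \<Longrightarrow> P x = x"
proof -
  have "\<forall>x. \<exists>w\<in>W. x - w \<in> orth W"
    using complemented_part_eq_UNIV[OF W] unfolding complemented_part_def by blast
  then obtain P where P: "\<And>x. P x \<in> W" "\<And>x. x - P x \<in> orth W" by metis
  have adj: "is_adjoint ip P P"
    unfolding is_adjoint_def
  proof (intro allI)
    fix x y
    have "ip (P x) (y - P y) = 0" "ip (x - P x) (P y) = 0"
      using P ip_zero_commute unfolding orth_def by blast+
    then show "ip (P x) y = ip x (P y)" by (simp add: ip_diff_left ip_diff_right)
  qed
  have fixed: "P x = x" if "x \<in> W" for x
  proof -
    have "ip (x - P x) (x - P x) = 0"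
      using P[of x] that closed_submoduleD(6)[OF W] unfolding orth_def by blast
    then show ?thesis using ip_self_eq_0 by force
  qed
  then have "P \<circ> P = P" using P(1) by auto
  then have "is_projection ip P"
    using adj unfolding is_projection_def adjointable_operators_def by blast
  then show ?thesis using P(1) fixed by (rule that)
qed

section \<open>Invariant submodules\<close>

lemma invariant_projection_if_submodule:
  assumes "has_invariant_submodule A act T"
  shows "has_invariant_projection ip T"
proof -
  obtain W where W: "closed_submodule A act W" "W \<noteq> {0}" "W \<noteq> UNIV" "T ` W \<subseteq> W"
    using assms unfolding has_invariant_submodule_def by blast
  obtain P where P: "is_projection ip P" "\<And>x. P x \<in> W" "\<And>x. x \<in> W \<Longrightarrow> P x = x"
    using obtain_projection[OF W(1)] by blast
  have "P \<noteq> (\<lambda>_. 0)" using W(2) P(3) closed_submoduleD(2)[OF W(1)] by fastforce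
  moreover have "P \<noteq> id" using W(3) P(2) by (metis UNIV_eq_I id_apply)
  moreover have "P \<circ> T \<circ> P = T \<circ> P" using P(2,3) W(4) by fastforce
  ultimately show ?thesis using P(1) unfolding has_invariant_projection_def by blast
qed

text \<open>Serves both for projections and for solutions S with ST = T.\<close>

lemma invariant_submodule_fixed_points:
  assumes "S \<in> adjointable_operators ip" "S \<noteq> id"
    and "S z = z" "z \<noteq> 0" and "\<And>x. S x = x \<Longrightarrow> S (T x) = T x"
  shows "has_invariant_submodule A act T"
  unfolding has_invariant_submodule_def
proof (intro exI[of _ "{x. S x = x}"] conjI)
  show "closed_submodule A act {x. S x = x}" by (rule closed_submodule_fixed_points[OF assms(1)])
  show "{x. S x = x} \<noteq> {0}" using assms(3,4) by blast
  show "{x. S x = x} \<noteq> UNIV" using assms(2) by fastforce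
  show "T ` {x. S x = x} \<subseteq> {x. S x = x}" using assms(5) by blast
qed

lemma invariant_submodule_if_projection:
  assumes "has_invariant_projection ip T"
  shows "has_invariant_submodule A act T"
proof -
  obtain P where P: "is_projection ip P" "P \<noteq> (\<lambda>_. 0)" "P \<noteq> id" "P \<circ> T \<circ> P = T \<circ> P"
    using assms unfolding has_invariant_projection_def by blast
  obtain x where "P x \<noteq> 0" using P(2) by blast
  moreover have "P (P x) = P x"
    using P(1) unfolding is_projection_def by (metis comp_apply)
  moreover have "P (T x) = T x" if "P x = x" for x
    using that P(4) by (metis comp_apply)
  ultimately show ?thesis
    using P(1,3) invariant_submodule_fixed_points[of P "P x" T] unfolding is_projection_def by blast
qed

text \<open>The double complement of the range of \<open>S\<close> replaces the closure of the range, so that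
  continuity of \<open>T\<close> is not needed. If it is all of \<open>E\<close>, then \<open>S T = T\<close> and the fixed
  points of \<open>S\<close> form an invariant submodule instead.\<close>

lemma invariant_submodule_if_solution:
  assumes T: "T \<in> adjointable_operators ip" and sol: "has_nontrivial_solution ip T"
    and ex: "\<not> (T = (\<lambda>_. 0) \<and> simple_module A act)"
  shows "has_invariant_submodule A act T"
proof -
  obtain S where S: "S \<in> adjointable_operators ip" "S \<noteq> (\<lambda>_. 0)" "S \<noteq> id"
    and "S \<circ> T \<circ> S = T \<circ> S"
    using sol unfolding has_nontrivial_solution_def by blast
  then have STS: "S (T (S x)) = T (S x)" for x by (metis comp_apply)
  obtain z where z: "S z \<noteq> 0" using S(2) by blast
  obtain S' T' where adj: "is_adjoint ip S' S" "is_adjoint ip T' T"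
    using S(1) T unfolding adjointable_operators_def by blast
  note adj' = adj[THEN is_adjoint_commute]
  have S': "ip (S x) y = ip x (S' y)" "ip (S' x) y = ip x (S y)" for x y
    using adj(1) adj'(1) unfolding is_adjoint_def by auto
  have T': "ip (T x) y = ip x (T' y)" "ip (T' x) y = ip x (T y)" for x y
    using adj(2) adj'(2) unfolding is_adjoint_def by auto
  define V where "V = orth (range S)"
  show ?thesis
  proof (cases "orth V = UNIV")
    case False
    \<comment> \<open>T maps the range of S into itself, so T* preserves its complement V, and T in
      turn preserves the complement of V.\<close>
    have "T x \<in> orth V" if "x \<in> orth V" for x
    proof -
      have "T' y \<in> V" if "y \<in> V" for y
        unfolding V_def orth_def
      proof (intro CollectI ballI)
        fix s assume "s \<in> range S"
        then have "T s \<in> range S" using STS by (metis imageE rangeI)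
        then show "ip s (T' y) = 0"
          using that unfolding V_def orth_def T'(1)[symmetric] by blast
      qed
      then show ?thesis using that by (simp add: orth_def flip: T'(2))
    qed
    moreover have "S z \<in> orth V" using subset_orth_orth[of "range S"] unfolding V_def by blast
    ultimately show ?thesis
      using False z closed_submodule_orth[of V] unfolding has_invariant_submodule_def by blast
  next
    case True
    then have V0: "v = 0" if "v \<in> V" for v
      using that ip_self_eq_0 unfolding orth_def by blast
    \<comment> \<open>By STS = TS, the values of T*(S* - I) are orthogonal to the range of S, so
      they lie in V = {0}. Hence T*S* = T*, and the adjoint of this is ST = T.\<close>
    have ST: "S (T x) = T x" for x
    proof (rule ip_ext)
      fix y
      have "ip (S w) (T' (S' y - y)) = 0" for w
        unfolding T'(1)[symmetric] ip_diff_right S'(1)[symmetric] STS by simp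
      then have "T' (S' y - y) = 0" by (intro V0) (auto simp: V_def orth_def)
      moreover have "ip (T' (S' y - y)) x = ip y (S (T x)) - ip y (T x)"
        by (simp add: T' S' ip_diff_left)
      ultimately show "ip y (S (T x)) = ip y (T x)"
        by (simp add: ip_zero_left)
    qed
    show ?thesis
    proof (cases "T = (\<lambda>_. 0)")
      case False
      then obtain x where "T x \<noteq> 0" by blast
      then show ?thesis using invariant_submodule_fixed_points[of S "T x" T] S ST by blast
    next
      case T0: True
      \<comment> \<open>E is nonzero because it contains \<open>S z\<close>; since it is not simple,
        a nontrivial W exists.\<close>
      then obtain W where W: "closed_submodule A act W" "W \<noteq> {0}" "W \<noteq> UNIV"
        using ex z unfolding simple_module_def by blast
      then show ?thesis
        using T0 closed_submoduleD(2)[OF W(1)] unfolding has_invariant_submodule_def by blast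
    qed
  qed
qed

end

theorem corollary3p1:
  fixes A :: "('h::complex_hilbert \<Rightarrow>\<^sub>L 'h) set"
    and act :: "'e::{complex_normed_vector, banach} \<Rightarrow> ('h \<Rightarrow>\<^sub>L 'h) \<Rightarrow> 'e"
    and ip :: "'e \<Rightarrow> 'e \<Rightarrow> ('h \<Rightarrow>\<^sub>L 'h)"
    and T :: "'e \<Rightarrow> 'e"
  assumes "hilbert_module A act ip"
    and "T \<in> adjointable_operators ip"
  shows "(has_invariant_submodule A act T \<longleftrightarrow> has_invariant_projection ip T) \<and>
    (\<not> (T = (\<lambda>_. 0) \<and> simple_module A act) \<longrightarrow>
      (has_invariant_submodule A act T \<longleftrightarrow> has_nontrivial_solution ip T) \<and>
      (has_invariant_projection ip T \<longleftrightarrow> has_nontrivial_solution ip T))"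
proof -
  interpret hilbert_module A act ip by fact
  have "has_invariant_projection ip T \<Longrightarrow> has_nontrivial_solution ip T"
    unfolding has_invariant_projection_def has_nontrivial_solution_def is_projection_def by blast
  then show ?thesis
    using assms(2) invariant_projection_if_submodule invariant_submodule_if_projection
      invariant_submodule_if_solution by blast
qed

end
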